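(* Let $\vec{\gamma}(t)=\vec{\xi}(\cos t,\sin t)$, $t\in[0,2\pi]$, be the image of the unit circle under the Gaussian random field $\vec{\xi}:\mathbb{R}^2\to\mathbb{R}^3$ described in the context. Then with probability one the random curve $\gamma$ has no points of self-intersection, namely $$P\{\exists\, t,s\in[0,2\pi),\ t\neq s:\ \vec{\gamma}(t)=\vec{\gamma}(s)\}=0.$$
   Context: $\vec{\xi}=(\xi_1,\xi_2,\xi_3):\mathbb{R}^2\to\mathbb{R}^3$ is a centered Gaussian random field on a probability space $(\Omega,\mathcal{F},P)$ whose coordinates $\xi_1,\xi_2,\xi_3$ are independent and identically distributed with covariance $E\,\xi_1(\vec{u})\xi_1(\vec{v})=e^{-\|\vec{u}-\vec{v}\|^2}$, $\vec{u},\vec{v}\in\mathbb{R}^2$. Since the covariance is infinitely differentiable, $\vec{\xi}$ has a modification with infinitely differentiable sample paths on $\mathbb{R}^2$; this modification is used throughout. *)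

theory Defs
  imports "HOL-Probability.Probability"
begin

text \<open>A point mass at zero counts as a (degenerate) centered Gaussian variable.\<close>

definition centered_gaussian :: "'a measure \<Rightarrow> ('a \<Rightarrow> real) \<Rightarrow> bool" where
  "centered_gaussian M X \<longleftrightarrow>
     X \<in> borel_measurable M \<and>
     (distr M borel X = return borel 0 \<or>
      (\<exists>\<sigma>>0. distributed M lborel X (\<lambda>x. ennreal (normal_density 0 \<sigma> x))))"

text \<open>All finite-dimensional distributions are centered Gaussian, i.e. every linear functional
  of finitely many values of the field is a centered Gaussian variable.\<close>

definition centered_gaussian_field ::
    "'a measure \<Rightarrow> ('i \<Rightarrow> 'a \<Rightarrow> 'b::euclidean_space) \<Rightarrow> bool" where
  "centered_gaussian_field M X \<longleftrightarrow>
     (\<forall>u. X u \<in> borel_measurable M) \<and>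
     (\<forall>T c. finite T \<longrightarrow> centered_gaussian M (\<lambda>\<omega>. \<Sum>u\<in>T. c u \<bullet> X u \<omega>))"

text \<open>The \<open>i\<close>-th coordinate of a vector-valued field, as a random element of the space of all
  real functions on the parameter set (to be used with the product \<sigma>-algebra).\<close>

definition coordinate_field :: "('i \<Rightarrow> 'a \<Rightarrow> real ^ 'n) \<Rightarrow> 'n \<Rightarrow> 'a \<Rightarrow> 'i \<Rightarrow> real" where
  "coordinate_field X i \<omega> = (\<lambda>u. X u \<omega> $ i)"

text \<open>Independence and equality in law are those of the coordinates as whole processes, not just
  of their values at a single parameter.\<close>

definition iid_coordinates :: "'a measure \<Rightarrow> ('i \<Rightarrow> 'a \<Rightarrow> real ^ 'n) \<Rightarrow> bool" where
  "iid_coordinates M X \<longleftrightarrow>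
     prob_space.indep_vars M (\<lambda>_. Pi\<^sub>M UNIV (\<lambda>_. borel)) (coordinate_field X) UNIV \<and>
     (\<forall>i j. distr M (Pi\<^sub>M UNIV (\<lambda>_. borel)) (coordinate_field X i) =
            distr M (Pi\<^sub>M UNIV (\<lambda>_. borel)) (coordinate_field X j))"

text \<open>On a finite-dimensional domain this is the class \<open>C\<^sup>k\<close>: all iterated directional derivatives
  up to order \<open>k\<close> exist and are continuous.\<close>

primrec k_times_continuously_differentiable ::
    "nat \<Rightarrow> ('a::real_normed_vector \<Rightarrow> 'b::real_normed_vector) \<Rightarrow> bool" where
  "k_times_continuously_differentiable 0 f \<longleftrightarrow> continuous_on UNIV f"
| "k_times_continuously_differentiable (Suc k) f \<longleftrightarrow>
     (\<forall>x. f differentiable (at x)) \<and>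
     (\<forall>v. k_times_continuously_differentiable k (\<lambda>x. frechet_derivative f (at x) v))"

definition infinitely_differentiable ::
    "('a::real_normed_vector \<Rightarrow> 'b::real_normed_vector) \<Rightarrow> bool" where
  "infinitely_differentiable f \<longleftrightarrow> (\<forall>k. k_times_continuously_differentiable k f)"

definition circle_image :: "(real ^ 2 \<Rightarrow> 'a \<Rightarrow> 'b) \<Rightarrow> real \<Rightarrow> 'a \<Rightarrow> 'b" where
  "circle_image \<xi> t = \<xi> (vector [cos t, sin t])"

end

theory Submission
  imports Defs
begin

text \<open>A self-intersection of \<open>\<gamma>\<close> is a zero, off the diagonal, of the field
  \<open>X (t, s) = \<gamma> t - \<gamma> s\<close>, which has two parameters and three coordinates. Three equations in two
  unknowns should have no solution, and the following count makes this rigorous.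

  Away from the diagonal the components of \<open>X (t, s)\<close> are independent centered
  Gaussian variables with common variance
  \<open>2 - 2 * exp (- \<parallel>u - v\<parallel>\<^sup>2)\<close>, where \<open>u\<close> and \<open>v\<close> are the points of the circle at \<open>t\<close> and \<open>s\<close>. On a
  compact subset of \<open>{0..<2*pi} \<times> {0..<2*pi}\<close> avoiding the diagonal this variance is bounded below, so
  \<open>P (\<parallel>X (t, s)\<parallel> \<le> \<epsilon>) \<le> C * \<epsilon> ^ 3\<close> uniformly
  (\<open>iid_coordinates_increment_small_ball\<close>, \<open>centered_gaussian_small_ball\<close>). The smoothness of
  the paths makes each of them Lipschitz along the circle
  (\<open>C1_circle_lipschitz\<close>). If the Lipschitz constant of \<open>X\<close> is at most \<open>m\<close>, then a zero forces
  \<open>\<parallel>X q\<parallel> \<le> m / N\<close> at some point \<open>q\<close> of a grid with mesh \<open>1 / N\<close>. The grid has \<open>O(N\<^sup>2)\<close> points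
  (\<open>plane_set_grid_cover\<close>), so this happens with probability \<open>O(N\<^sup>2 * (m / N) ^ 3) = O(1 / N)\<close>, and
  letting \<open>N\<close> tend to infinity leaves probability zero (\<open>lipschitz_field_zeros_null\<close>).
  Countably many values of \<open>m\<close> and countably many compact sets exhaust all the cases.

  The underlying space need not be complete, so the measurability of the event has content. It
  comes from the same argument: by compactness, the grid condition for every \<open>N\<close> and some \<open>m\<close>
  is equivalent to the existence of a zero, which presents the event through countably many
  measurable ones.\<close>

section \<open>Zeros of Lipschitz random fields\<close>

text \<open>The covering exponent \<open>d\<close> plays the part of the dimension of the parameter set and \<open>k\<close> that
  of the number of coordinates: the union bound over a cover costs \<open>N ^ d\<close> and the small ball
  probability gains \<open>(1 / N) ^ k\<close>. The event that the path is
  \<open>m\<close>-Lipschitz is replaced by its consequence at the points of the finite covers, which is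
  visibly measurable.\<close>

lemma lipschitz_field_zeros_null:
  fixes X :: "'p::metric_space \<Rightarrow> 'a \<Rightarrow> 'b::euclidean_space"
  assumes "prob_space M"
    and K: "compact K"
    and meas: "\<And>p. p \<in> K \<Longrightarrow> X p \<in> borel_measurable M"
    and lip: "\<And>\<omega>. \<omega> \<in> space M \<Longrightarrow> \<exists>L. L-lipschitz_on K (\<lambda>p. X p \<omega>)"
    and small: "\<And>p \<epsilon>. p \<in> K \<Longrightarrow> \<epsilon> \<ge> 0 \<Longrightarrow>
                  measure M {\<omega> \<in> space M. norm (X p \<omega>) \<le> \<epsilon>} \<le> C * \<epsilon> ^ k"
    and cover: "\<And>N::nat. N > 0 \<Longrightarrow>
                  \<exists>F\<subseteq>K. finite F \<and> real (card F) \<le> b * real N ^ d \<and> (\<forall>p\<in>K. \<exists>q\<in>F. dist p q \<le> 1 / N)"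
    and "d < k"
  shows "{\<omega> \<in> space M. \<exists>p\<in>K. X p \<omega> = 0} \<in> null_sets M"
proof -
  interpret prob_space M by fact
  have "\<forall>N. \<exists>F. F \<subseteq> K \<and> finite F \<and> real (card F) \<le> b * real (Suc N) ^ d \<and>
      (\<forall>p\<in>K. \<exists>q\<in>F. dist p q \<le> 1 / real (Suc N))"
    using cover[of "Suc _"] by (meson zero_less_Suc)
  then obtain F where F: "\<And>N. F N \<subseteq> K" "\<And>N. finite (F N)"
      "\<And>N. real (card (F N)) \<le> b * real (Suc N) ^ d"
      "\<And>N p. p \<in> K \<Longrightarrow> \<exists>q\<in>F N. dist p q \<le> 1 / real (Suc N)"
    by (auto simp: choice_iff)
  \<comment> \<open>A path that is \<open>m\<close>-Lipschitz and vanishes somewhere on \<open>K\<close> lies in \<open>E m N\<close> for every \<open>N\<close>.\<close>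
  define E where "E m N = (\<Union>q\<in>F N. {\<omega> \<in> space M. norm (X q \<omega>) \<le> real m / real (Suc N)})" for m N
  have E_sets: "E m N \<in> sets M" for m N
    unfolding E_def
  proof (intro sets.finite_UN F(2))
    fix q assume "q \<in> F N"
    then have [measurable]: "X q \<in> borel_measurable M"
      using meas F(1) by blast
    show "{\<omega> \<in> space M. norm (X q \<omega>) \<le> real m / real (Suc N)} \<in> sets M"
      by measurable
  qed
  have E_small: "measure M (E m N) \<le> (b * \<bar>C\<bar> * real m ^ k) / real (Suc N)" for m N
  proof -
    have "b * real (Suc N) ^ d \<ge> 0"
      using F(3)[of N] by (meson of_nat_0_le_iff order_trans)
    moreover have "real (Suc N) ^ d > 0"
      by simp
    ultimately have b: "b \<ge> 0"
      by (simp only: zero_le_mult_iff) linarith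
    have "measure M (E m N) \<le> (\<Sum>q\<in>F N. measure M {\<omega> \<in> space M. norm (X q \<omega>) \<le> real m / real (Suc N)})"
      unfolding E_def
    proof (rule finite_measure_subadditive_finite[OF F(2)], safe)
      fix q assume "q \<in> F N"
      then have [measurable]: "X q \<in> borel_measurable M"
        using meas F(1) by blast
      show "{\<omega> \<in> space M. norm (X q \<omega>) \<le> real m / real (Suc N)} \<in> sets M"
        by measurable
    qed
    also have "\<dots> \<le> (\<Sum>q\<in>F N. \<bar>C\<bar> * (real m / real (Suc N)) ^ k)"
    proof (rule sum_mono)
      fix q assume "q \<in> F N"
      then have "measure M {\<omega> \<in> space M. norm (X q \<omega>) \<le> real m / real (Suc N)}
          \<le> C * (real m / real (Suc N)) ^ k"
        using F(1) by (intro small) auto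
      also have "\<dots> \<le> \<bar>C\<bar> * (real m / real (Suc N)) ^ k"
        by (intro mult_right_mono) auto
      finally show "measure M {\<omega> \<in> space M. norm (X q \<omega>) \<le> real m / real (Suc N)}
          \<le> \<bar>C\<bar> * (real m / real (Suc N)) ^ k" .
    qed
    also have "\<dots> = real (card (F N)) * (\<bar>C\<bar> * (real m / real (Suc N)) ^ k)"
      by simp
    also have "\<dots> \<le> (b * real (Suc N) ^ d) * (\<bar>C\<bar> * (real m / real (Suc N)) ^ k)"
      using F(3) by (intro mult_right_mono) auto
    also have "\<dots> = (b * \<bar>C\<bar> * real m ^ k) * (real (Suc N) ^ d / real (Suc N) ^ k)"
      by (simp add: power_divide)
    also have "\<dots> \<le> (b * \<bar>C\<bar> * real m ^ k) * (1 / real (Suc N))"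
    proof (rule mult_left_mono)
      have "real (Suc N) ^ Suc d \<le> real (Suc N) ^ k"
        using \<open>d < k\<close> by (intro power_increasing) auto
      then show "real (Suc N) ^ d / real (Suc N) ^ k \<le> 1 / real (Suc N)"
        by (simp add: divide_simps mult.commute del: of_nat_Suc)
    qed (use b in auto)
    finally show ?thesis by simp
  qed
  have null: "(\<Inter>N. E m N) \<in> null_sets M" for m
  proof -
    have sets: "(\<Inter>N. E m N) \<in> sets M"
      using E_sets by auto
    have "measure M (\<Inter>N. E m N) \<le> (b * \<bar>C\<bar> * real m ^ k) / real (Suc N)" for N
      using E_small[of m N] finite_measure_mono[of "\<Inter>N. E m N" "E m N"] E_sets by force
    moreover have "(\<lambda>N. (b * \<bar>C\<bar> * real m ^ k) / real (Suc N)) \<longlonglongrightarrow> 0"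
      using LIMSEQ_Suc[OF lim_const_over_n] .
    ultimately have "measure M (\<Inter>N. E m N) \<le> 0"
      by (intro LIMSEQ_le_const) auto
    then have "measure M (\<Inter>N. E m N) = 0"
      by (simp add: measure_le_0_iff)
    with sets show ?thesis
      by (simp add: null_sets_def emeasure_eq_measure)
  qed
  have "{\<omega> \<in> space M. \<exists>p\<in>K. X p \<omega> = 0} = (\<Union>m. \<Inter>N. E m N)"
  proof safe
    fix \<omega> p assume \<omega>: "\<omega> \<in> space M" and p: "p \<in> K" "X p \<omega> = 0"
    obtain L where L: "L-lipschitz_on K (\<lambda>p. X p \<omega>)"
      using lip \<omega> by blast
    have L0: "L \<ge> 0" using L by (rule lipschitz_on_nonneg)
    obtain m :: nat where m: "L \<le> real m" using real_arch_simple by blast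
    have "\<omega> \<in> E m N" for N
    proof -
      obtain q where q: "q \<in> F N" "dist p q \<le> 1 / real (Suc N)"
        using F(4) p by blast
      then have "norm (X q \<omega>) = dist (X p \<omega>) (X q \<omega>)"
        using p by simp
      also have "\<dots> \<le> L * dist p q"
        using lipschitz_onD[OF L] p q F(1) by blast
      also have "\<dots> \<le> real m * (1 / real (Suc N))"
        using m q L0 by (intro mult_mono) auto
      finally show ?thesis
        using q \<omega> by (auto simp: E_def)
    qed
    then show "\<omega> \<in> (\<Union>m. \<Inter>N. E m N)" by blast
  next
    fix \<omega> m assume *: "\<omega> \<in> (\<Inter>N. E m N)"
    then have \<omega>: "\<omega> \<in> space M" by (auto simp: E_def)
    have "\<forall>N. \<exists>q. q \<in> K \<and> norm (X q \<omega>) \<le> real m / real (Suc N)"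
      using * F(1) unfolding E_def by blast
    then obtain q where q: "\<And>N. q N \<in> K" "\<And>N. norm (X (q N) \<omega>) \<le> real m / real (Suc N)"
      by metis
    \<comment> \<open>The value at \<open>q N\<close> tends to zero, so every limit point of \<open>q\<close> is a zero of the path.\<close>
    obtain p r where p: "p \<in> K" "strict_mono (r::nat\<Rightarrow>nat)" "(q \<circ> r) \<longlonglongrightarrow> p"
      using seq_compactE[of K q] compact_imp_seq_compact[OF K] q(1) by blast
    have "continuous_on K (\<lambda>p. X p \<omega>)"
      using lip[OF \<omega>] lipschitz_on_continuous_on by blast
    then have "(\<lambda>n. X ((q \<circ> r) n) \<omega>) \<longlonglongrightarrow> X p \<omega>"
      using p q(1) by (auto simp: continuous_on_sequentially o_def)
    moreover have "(\<lambda>N. X (q N) \<omega>) \<longlonglongrightarrow> 0"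
    proof (rule Lim_null_comparison)
      show "\<forall>\<^sub>F N in sequentially. norm (X (q N) \<omega>) \<le> real m / real (Suc N)"
        using q(2) by (intro always_eventually allI)
      show "(\<lambda>N. real m / real (Suc N)) \<longlonglongrightarrow> 0"
        by (rule LIMSEQ_Suc[OF lim_const_over_n])
    qed
    from LIMSEQ_subseq_LIMSEQ[OF this p(2)] have "(\<lambda>n. X ((q \<circ> r) n) \<omega>) \<longlonglongrightarrow> 0"
      by (simp add: o_def)
    ultimately have "X p \<omega> = 0"
      using LIMSEQ_unique by blast
    then show "\<exists>p\<in>K. X p \<omega> = 0" using p by blast
  qed (auto simp: E_def)
  with null show ?thesis by auto
qed

text \<open>Cut the square into cells of side \<open>1 / (2 * N)\<close>, so that two points of one cell are at most
  \<open>1 / N\<close> apart, and choose a point of \<open>K\<close> in every cell that meets \<open>K\<close>. Choosing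
  them in \<open>K\<close> itself lets an estimate that holds only on \<open>K\<close> be applied to them.\<close>

lemma plane_set_grid_cover:
  fixes K :: "(real \<times> real) set"
  assumes K: "K \<subseteq> {0..real a} \<times> {0..real a}" and N: "(N::nat) > 0"
  shows "\<exists>F\<subseteq>K. finite F \<and> real (card F) \<le> (2 * real a + 1)\<^sup>2 * real N ^ 2 \<and>
           (\<forall>p\<in>K. \<exists>q\<in>F. dist p q \<le> 1 / real N)"
proof -
  define c where "c = (\<lambda>p::real\<times>real. (\<lfloor>2 * N * fst p\<rfloor>, \<lfloor>2 * N * snd p\<rfloor>))"
  define F where "F = inv_into K c ` c ` K"
  have *: "0 \<le> \<lfloor>2 * N * x\<rfloor> \<and> \<lfloor>2 * N * x\<rfloor> \<le> int (2 * a * N)" if "0 \<le> x" "x \<le> real a" for x :: real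
  proof -
    have "2 * real N * x \<le> 2 * real N * real a"
      using that by (intro mult_left_mono) auto
    then have "2 * real N * x \<le> real_of_int (int (2 * a * N))" by (simp add: mult_ac)
    then show ?thesis using that by (simp add: floor_le_iff)
  qed
  have sub: "c ` K \<subseteq> {0..int (2*a*N)} \<times> {0..int (2*a*N)}"
    using K * by (fastforce simp: c_def)
  then have fin: "finite (c ` K)"
    by (rule finite_subset) auto
  have "card F \<le> card (c ` K)"
    unfolding F_def by (rule card_image_le[OF fin])
  also have "\<dots> \<le> card ({0..int (2*a*N)} \<times> {0..int (2*a*N)})"
    by (rule card_mono[OF _ sub]) auto
  also have "\<dots> = (2*a*N+1)\<^sup>2"
    by (simp add: card_cartesian_product power2_eq_square nat_add_distrib nat_mult_distrib)
  also have "\<dots> \<le> ((2*a+1)*N)\<^sup>2"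
    using N by (intro power_mono) (auto simp: algebra_simps)
  finally have "real (card F) \<le> real (((2*a+1)*N)\<^sup>2)"
    by (rule of_nat_mono)
  then have card: "real (card F) \<le> (2 * real a + 1)\<^sup>2 * real N ^ 2"
    by (simp add: power_mult_distrib[symmetric] algebra_simps)
  have near: "\<exists>q\<in>F. dist p q \<le> 1 / real N" if p: "p \<in> K" for p
  proof (intro bexI)
    let ?q = "inv_into K c (c p)"
    show "?q \<in> F" using p by (auto simp: F_def)
    have "c ?q = c p" using p by (simp add: f_inv_into_f)
    then have "\<lfloor>2 * N * fst ?q\<rfloor> = \<lfloor>2 * N * fst p\<rfloor>" "\<lfloor>2 * N * snd ?q\<rfloor> = \<lfloor>2 * N * snd p\<rfloor>"
      by (simp_all add: c_def)
    then have "\<bar>2 * N * fst p - 2 * N * fst ?q\<bar> \<le> 1" "\<bar>2 * N * snd p - 2 * N * snd ?q\<bar> \<le> 1"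
      by linarith+
    then have "2 * N * \<bar>fst p - fst ?q\<bar> \<le> 1" "2 * N * \<bar>snd p - snd ?q\<bar> \<le> 1"
      by (simp_all add: abs_mult flip: right_diff_distrib)
    then have "\<bar>fst p - fst ?q\<bar> + \<bar>snd p - snd ?q\<bar> \<le> 1 / real N"
      using N by (simp add: field_simps)
    moreover have "dist p ?q \<le> \<bar>fst p - fst ?q\<bar> + \<bar>snd p - snd ?q\<bar>"
      by (simp add: dist_prod_def dist_real_def sqrt_sum_squares_le_sum_abs)
    ultimately show "dist p ?q \<le> 1 / real N" by linarith
  qed
  have "F \<subseteq> K" by (auto simp only: F_def image_iff intro!: inv_into_into)
  then show ?thesis using card near fin by (intro exI[of _ F]) (auto simp: F_def)
qed

section \<open>Small balls of Gaussian increments\<close>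

text \<open>The normal density is at most \<open>1 / (sqrt (2 * pi) * \<sigma>)\<close>, rounded up here to \<open>1 / (2 * \<sigma>)\<close>,
  and the interval has length \<open>2 * \<epsilon>\<close>.\<close>

lemma normal_interval_prob_le:
  assumes "prob_space M" and X: "distributed M lborel X (\<lambda>x. ennreal (normal_density \<mu> \<sigma> x))"
    and "\<sigma> > 0" "\<epsilon> \<ge> 0"
  shows "measure M {\<omega> \<in> space M. \<bar>X \<omega>\<bar> \<le> \<epsilon>} \<le> \<epsilon> / \<sigma>"
proof -
  interpret prob_space M by fact
  have le: "normal_density \<mu> \<sigma> x \<le> 1 / (2 * \<sigma>)" for x
  proof -
    have "2 \<le> sqrt (2 * pi)"
      using pi_gt3 by (intro real_le_rsqrt) simp
    then have "2 * \<sigma> \<le> sqrt (2 * pi) * \<sigma>"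
      using \<open>\<sigma> > 0\<close> by simp
    also have "\<dots> = sqrt (2 * pi * \<sigma>\<^sup>2)"
      using \<open>\<sigma> > 0\<close> by (simp add: real_sqrt_mult)
    finally have s: "2 * \<sigma> \<le> sqrt (2 * pi * \<sigma>\<^sup>2)" .
    have "normal_density \<mu> \<sigma> x \<le> 1 / sqrt (2 * pi * \<sigma>\<^sup>2) * 1"
      unfolding normal_density_def using \<open>\<sigma> > 0\<close> by (intro mult_left_mono) auto
    also have "\<dots> \<le> 1 / (2 * \<sigma>)"
      using s \<open>\<sigma> > 0\<close> by (simp add: frac_le)
    finally show ?thesis .
  qed
  have "{\<omega> \<in> space M. \<bar>X \<omega>\<bar> \<le> \<epsilon>} = X -` {-\<epsilon>..\<epsilon>} \<inter> space M" by (auto simp: abs_le_iff)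
  then have "emeasure M {\<omega> \<in> space M. \<bar>X \<omega>\<bar> \<le> \<epsilon>} =
      (\<integral>\<^sup>+x. ennreal (normal_density \<mu> \<sigma> x) * indicator {-\<epsilon>..\<epsilon>} x \<partial>lborel)"
    using distributed_emeasure[OF X, of "{-\<epsilon>..\<epsilon>}"] by simp
  also have "\<dots> \<le> (\<integral>\<^sup>+x. ennreal (1 / (2 * \<sigma>)) * indicator {-\<epsilon>..\<epsilon>} x \<partial>lborel)"
    by (intro nn_integral_mono mult_right_mono ennreal_leI le) auto
  also have "\<dots> = ennreal (1 / (2 * \<sigma>)) * ennreal (2 * \<epsilon>)"
    using \<open>\<epsilon> \<ge> 0\<close> by (subst nn_integral_cmult_indicator) auto
  also have "\<dots> = ennreal (\<epsilon> / \<sigma>)"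
    using assms(3,4) by (simp flip: ennreal_mult)
  finally show ?thesis
    using assms(3,4) by (simp add: emeasure_eq_measure)
qed

text \<open>A positive second moment excludes the point mass at zero and identifies the variance
  parameter of the density.\<close>

lemma centered_gaussian_small_ball:
  assumes "prob_space M" and X: "centered_gaussian M X"
    and v: "(\<integral>\<omega>. (X \<omega>)\<^sup>2 \<partial>M) = v" and "v > 0" "\<epsilon> \<ge> 0"
  shows "measure M {\<omega> \<in> space M. \<bar>X \<omega>\<bar> \<le> \<epsilon>} \<le> \<epsilon> / sqrt v"
proof -
  interpret prob_space M by fact
  have [measurable]: "X \<in> borel_measurable M"
    using X by (simp add: centered_gaussian_def)
  consider "distr M borel X = return borel 0"
    | \<sigma> where "\<sigma> > 0" "distributed M lborel X (\<lambda>x. ennreal (normal_density 0 \<sigma> x))"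
    using X by (auto simp: centered_gaussian_def)
  then show ?thesis
  proof cases
    case 1
    have "v = (\<integral>x. x\<^sup>2 \<partial>distr M borel X)"
      unfolding v[symmetric] by (subst integral_distr) auto
    also have "\<dots> = 0"
      unfolding 1 by (subst integral_return) auto
    finally show ?thesis using \<open>v > 0\<close> by simp
  next
    case 2
    have "expectation X = 0"
      using normal_distributed_expectation[OF 2(1,2)] .
    then have "v = \<sigma>\<^sup>2"
      using normal_distributed_variance[OF 2(1,2)] v by simp
    then have "sqrt v = \<sigma>" using \<open>\<sigma> > 0\<close> by simp
    then show ?thesis
      using normal_interval_prob_le[OF assms(1) 2(2,1) \<open>\<epsilon> \<ge> 0\<close>] by simp
  qed
qed

text \<open>If the norm is at most \<open>\<epsilon>\<close>, so is every coordinate. These coordinate events are the preimages,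
  under the independent and identically distributed coordinate processes, of one set in the
  product \<open>\<sigma>\<close>-algebra; their probabilities therefore multiply and are all equal.\<close>

lemma iid_coordinates_increment_small_ball:
  fixes \<xi> :: "'i \<Rightarrow> 'a \<Rightarrow> real ^ 'n" and \<epsilon> :: real
  assumes "prob_space M" and iid: "iid_coordinates M \<xi>"
  shows "measure M {\<omega> \<in> space M. norm (\<xi> u \<omega> - \<xi> v \<omega>) \<le> \<epsilon>} \<le>
         measure M {\<omega> \<in> space M. \<bar>\<xi> u \<omega> $ j - \<xi> v \<omega> $ j\<bar> \<le> \<epsilon>} ^ CARD('n)"
proof -
  interpret prob_space M by fact
  let ?P = "Pi\<^sub>M UNIV (\<lambda>_. borel) :: ('i \<Rightarrow> real) measure"
  define S where "S = {x \<in> space ?P. \<bar>x u - x v\<bar> \<le> \<epsilon>}"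
  have S: "S \<in> sets ?P"
    unfolding S_def by measurable
  have ind: "indep_vars (\<lambda>_. ?P) (coordinate_field \<xi>) UNIV"
    and law: "\<And>i j. distr M ?P (coordinate_field \<xi> i) = distr M ?P (coordinate_field \<xi> j)"
    using iid by (auto simp: iid_coordinates_def)
  have cm: "coordinate_field \<xi> i \<in> measurable M ?P" for i
    using ind by (auto simp: indep_vars_def)
  have pre: "coordinate_field \<xi> i -` S \<inter> space M = {\<omega> \<in> space M. \<bar>\<xi> u \<omega> $ i - \<xi> v \<omega> $ i\<bar> \<le> \<epsilon>}" for i
    by (auto simp: S_def coordinate_field_def space_PiM)
  have same: "prob (coordinate_field \<xi> i -` S \<inter> space M) = prob (coordinate_field \<xi> j -` S \<inter> space M)" for i
    using law[of i j] measure_distr[OF cm S] by metis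
  have "{\<omega> \<in> space M. norm (\<xi> u \<omega> - \<xi> v \<omega>) \<le> \<epsilon>} \<subseteq> (\<Inter>i\<in>UNIV. coordinate_field \<xi> i -` S \<inter> space M)"
  proof (clarsimp simp: pre)
    fix \<omega> i assume "norm (\<xi> u \<omega> - \<xi> v \<omega>) \<le> \<epsilon>"
    moreover have "\<bar>(\<xi> u \<omega> - \<xi> v \<omega>) $ i\<bar> \<le> norm (\<xi> u \<omega> - \<xi> v \<omega>)"
      by (rule component_le_norm_cart)
    ultimately show "\<bar>\<xi> u \<omega> $ i - \<xi> v \<omega> $ i\<bar> \<le> \<epsilon>" by simp
  qed
  then have "prob {\<omega> \<in> space M. norm (\<xi> u \<omega> - \<xi> v \<omega>) \<le> \<epsilon>} \<le> prob (\<Inter>i\<in>UNIV. coordinate_field \<xi> i -` S \<inter> space M)"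
    using measurable_sets[OF cm S] by (intro finite_measure_mono sets.finite_INT) auto
  also have "\<dots> = (\<Prod>i\<in>UNIV. prob (coordinate_field \<xi> i -` S \<inter> space M))"
    using S by (intro indep_varsD[OF ind]) auto
  also have "\<dots> = (\<Prod>i\<in>(UNIV::'n set). prob (coordinate_field \<xi> j -` S \<inter> space M))"
    using same by (intro prod.cong) auto
  finally show ?thesis by (simp add: pre)
qed

text \<open>The hypotheses force integrability: the Bochner integral of a function that is not integrable
  is zero, whereas the three integrals here are nonzero.\<close>

lemma increment_second_moment:
  fixes X Y :: "'a \<Rightarrow> real"
  assumes "(\<integral>\<omega>. X \<omega> * X \<omega> \<partial>M) = 1" "(\<integral>\<omega>. Y \<omega> * Y \<omega> \<partial>M) = 1"
    and "(\<integral>\<omega>. X \<omega> * Y \<omega> \<partial>M) = \<rho>" "\<rho> \<noteq> 0"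
  shows "(\<integral>\<omega>. (X \<omega> - Y \<omega>)\<^sup>2 \<partial>M) = 2 - 2 * \<rho>"
proof -
  have "integrable M (\<lambda>\<omega>. X \<omega> * X \<omega>)" "integrable M (\<lambda>\<omega>. Y \<omega> * Y \<omega>)" "integrable M (\<lambda>\<omega>. X \<omega> * Y \<omega>)"
    by (rule ccontr; use assms in \<open>simp add: not_integrable_integral_eq\<close>)+
  moreover have "(\<lambda>\<omega>. (X \<omega> - Y \<omega>)\<^sup>2) = (\<lambda>\<omega>. X \<omega> * X \<omega> + Y \<omega> * Y \<omega> - 2 * (X \<omega> * Y \<omega>))"
    by (auto simp: power2_eq_square algebra_simps)
  ultimately show ?thesis
    using assms by simp
qed

section \<open>Regularity of the curve\<close>

lemma vector_2_eq_axis_sum: "(vector [x, y] :: real ^ 2) = x *\<^sub>R axis 1 1 + y *\<^sub>R axis 2 1"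
  by (simp add: vec_eq_iff forall_2 axis_def)

text \<open>The chain rule gives the derivative
  \<open>t \<mapsto> - sin t *\<^sub>R D f(c t) e\<^sub>1 + cos t *\<^sub>R D f(c t) e\<^sub>2\<close>, where \<open>c t\<close> is the point of the circle. It
  only involves directional derivatives in two fixed directions, so it is continuous and hence
  bounded on a compact interval; the mean value inequality turns the bound into a Lipschitz
  constant.\<close>

lemma C1_circle_lipschitz:
  fixes f :: "real ^ 2 \<Rightarrow> 'b::real_normed_vector"
  assumes f: "k_times_continuously_differentiable 1 f"
  shows "\<exists>L. L-lipschitz_on {a..b} (\<lambda>t. f (vector [cos t, sin t]))"
proof -
  let ?c = "\<lambda>t::real. vector [cos t, sin t] :: real^2"
  define f' where "f' x = frechet_derivative f (at x)" for x
  have der: "(f has_derivative f' x) (at x)" for x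
    using f by (simp add: frechet_derivative_works f'_def)
  have cont: "continuous_on UNIV (\<lambda>x. f' x v)" for v
    using f by (simp add: f'_def)
  define g where "g t = (- sin t) *\<^sub>R f' (?c t) (axis 1 1) + cos t *\<^sub>R f' (?c t) (axis 2 1)" for t
  have cc: "continuous_on UNIV ?c"
    unfolding vector_2_eq_axis_sum by (intro continuous_intros)
  have "continuous_on UNIV g"
    unfolding g_def using continuous_on_compose2[OF cont cc]
    by (intro continuous_intros) auto
  then have "bounded (g ` {a..b})"
    by (intro compact_imp_bounded compact_continuous_image) (auto intro: continuous_on_subset)
  then obtain B where B: "B > 0" "\<And>t. t \<in> {a..b} \<Longrightarrow> norm (g t) \<le> B"
    by (auto simp: bounded_pos)
  have gder: "((\<lambda>t. f (?c t)) has_derivative (\<lambda>h. h *\<^sub>R g t)) (at t within {a..b})" for t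
  proof -
    have "(?c has_derivative (\<lambda>h. (h * - sin t) *\<^sub>R axis 1 1 + (h * cos t) *\<^sub>R axis 2 1)) (at t within {a..b})"
      unfolding vector_2_eq_axis_sum by (auto intro!: derivative_eq_intros simp: algebra_simps)
    from has_derivative_compose[OF this der]
    have "((\<lambda>t. f (?c t)) has_derivative
        (\<lambda>h. f' (?c t) ((h * - sin t) *\<^sub>R axis 1 1 + (h * cos t) *\<^sub>R axis 2 1))) (at t within {a..b})" .
    moreover have "f' (?c t) ((h * - sin t) *\<^sub>R axis 1 1 + (h * cos t) *\<^sub>R axis 2 1) = h *\<^sub>R g t" for h
    proof -
      have "linear (f' (?c t))" using der has_derivative_linear by blast
      then show ?thesis by (simp add: linear_diff linear_scale g_def scaleR_diff_right)
    qed
    ultimately show ?thesis by simp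
  qed
  have "B-lipschitz_on {a..b} (\<lambda>t. f (?c t))"
  proof (rule lipschitz_onI)
    fix x y assume "x \<in> {a..b}" "y \<in> {a..b}"
    then have "norm (f (?c x) - f (?c y)) \<le> B * norm (x - y)"
      by (intro differentiable_bound[of "{a..b}" _ "\<lambda>t h. h *\<^sub>R g t"] gder)
         (auto intro!: onorm_le simp: B mult.commute[of B] mult_left_mono)
    then show "dist (f (?c x)) (f (?c y)) \<le> B * dist x y" by (simp add: dist_norm)
  qed (use B in auto)
  then show ?thesis by blast
qed

lemma difference_lipschitz:
  fixes g :: "real \<Rightarrow> 'b::real_normed_vector"
  assumes g: "L-lipschitz_on A g"
  shows "(2 * L)-lipschitz_on (A \<times> A) (\<lambda>p. g (fst p) - g (snd p))"
proof (rule lipschitz_onI)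
  have L: "L \<ge> 0" using g by (rule lipschitz_on_nonneg)
  then show "2 * L \<ge> 0" by simp
  fix p q assume "p \<in> A \<times> A" "q \<in> A \<times> A"
  then have "dist (g (fst p)) (g (fst q)) \<le> L * dist (fst p) (fst q)"
    "dist (g (snd p)) (g (snd q)) \<le> L * dist (snd p) (snd q)"
    by (auto intro!: lipschitz_onD[OF g])
  moreover have "L * dist (fst p) (fst q) \<le> L * dist p q" "L * dist (snd p) (snd q) \<le> L * dist p q"
    using L by (auto intro!: mult_left_mono dist_fst_le dist_snd_le)
  moreover have "dist (g (fst p) - g (snd p)) (g (fst q) - g (snd q)) \<le>
      dist (g (fst p)) (g (fst q)) + dist (g (snd p)) (g (snd q))"
    unfolding dist_norm by (rule order_trans[OF _ norm_triangle_ineq4]) (simp add: algebra_simps)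
  ultimately show "dist (g (fst p) - g (snd p)) (g (fst q) - g (snd q)) \<le> 2 * L * dist p q"
    by linarith
qed

section \<open>Self-intersections\<close>

lemma circle_param_inj:
  assumes "t \<in> {0..<2*pi}" "s \<in> {0..<2*pi}" "t \<noteq> s"
  shows "(vector [cos t, sin t] :: real^2) \<noteq> vector [cos s, sin s]"
proof
  assume "(vector [cos t, sin t] :: real^2) = vector [cos s, sin s]"
  then have "cos t = cos s" "sin t = sin s"
    by (auto simp: vec_eq_iff forall_2)
  then obtain n :: int where n: "t = s + 2 * pi * n"
    using sin_cos_eq_iff by blast
  then have "2 * pi * \<bar>real_of_int n\<bar> = \<bar>t - s\<bar>"
    by (simp add: abs_mult)
  also have "\<dots> < 2 * pi * 1"
    using assms by auto
  finally have "n = 0"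
    by simp
  with n \<open>t \<noteq> s\<close> show False by simp
qed

theorem theorem1p1:
  fixes M :: "'a measure" and \<xi> :: "real ^ 2 \<Rightarrow> 'a \<Rightarrow> real ^ 3"
  assumes "prob_space M"
    and "centered_gaussian_field M \<xi>"
    and "iid_coordinates M \<xi>"
    and "\<And>u v. (\<integral>\<omega>. \<xi> u \<omega> $ 1 * \<xi> v \<omega> $ 1 \<partial>M) = exp (- (norm (u - v))\<^sup>2)"
    and "\<And>\<omega>. \<omega> \<in> space M \<Longrightarrow> infinitely_differentiable (\<lambda>u. \<xi> u \<omega>)"
  shows "{\<omega> \<in> space M. \<exists>t\<in>{0..<2*pi}. \<exists>s\<in>{0..<2*pi}. t \<noteq> s \<and>
            circle_image \<xi> t \<omega> = circle_image \<xi> s \<omega>} \<in> sets M \<and>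
         measure M {\<omega> \<in> space M. \<exists>t\<in>{0..<2*pi}. \<exists>s\<in>{0..<2*pi}. t \<noteq> s \<and>
            circle_image \<xi> t \<omega> = circle_image \<xi> s \<omega>} = 0"
proof -
  interpret prob_space M by fact
  let ?c = "\<lambda>t::real. vector [cos t, sin t] :: real^2"
  define X where "X p \<omega> = circle_image \<xi> (fst p) \<omega> - circle_image \<xi> (snd p) \<omega>" for p \<omega>
  define \<delta> where "\<delta> n = 1 / real (Suc n)" for n
  \<comment> \<open>Compact sets that increase to the complement of the diagonal in \<open>{0..<2*pi} \<times> {0..<2*pi}\<close>.
    Keeping the distance \<open>\<delta> n\<close> from \<open>2*pi\<close> is essential: pairs near \<open>(0, 2*pi)\<close> are far from the
    diagonal, but their points on the circle almost coincide.\<close>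
  define K where "K n = ({0..2*pi - \<delta> n} \<times> {0..2*pi - \<delta> n}) \<inter> {p. \<delta> n \<le> \<bar>fst p - snd p\<bar>}" for n
  have \<xi>_meas [measurable]: "\<xi> u \<in> borel_measurable M" for u
    using assms(2) by (simp add: centered_gaussian_field_def)
  have combination_gaussian: "centered_gaussian M (\<lambda>\<omega>. \<Sum>u\<in>T. c u \<bullet> \<xi> u \<omega>)" if "finite T" for T c
    using assms(2) that by (simp add: centered_gaussian_field_def)
  have \<delta>: "\<delta> n > 0" for n by (simp add: \<delta>_def)
  have K_sub: "K n \<subseteq> {0..<2*pi} \<times> {0..<2*pi}" and K_neq: "p \<in> K n \<Longrightarrow> fst p \<noteq> snd p" for n p
    using \<delta>[of n] by (auto simp: K_def)
  have K_compact: "compact (K n)" for n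
    unfolding K_def
    by (intro compact_Int_closed compact_Times compact_Icc closed_Collect_le continuous_intros)
  have null: "{\<omega> \<in> space M. \<exists>p\<in>K n. X p \<omega> = 0} \<in> null_sets M" for n
  proof -
    define V where "V p = 2 - 2 * exp (- (norm (?c (fst p) - ?c (snd p)))\<^sup>2)" for p
    have V_pos: "V p > 0" if "p \<in> K n" for p
    proof -
      have "?c (fst p) \<noteq> ?c (snd p)"
        using circle_param_inj[of "fst p" "snd p"] K_sub[of n] K_neq[OF that] that by auto
      then show ?thesis by (simp add: V_def)
    qed
    have "\<exists>v>0. \<forall>p\<in>K n. v \<le> V p"
    proof (cases "K n = {}")
      case False
      have "continuous_on (K n) V"
        unfolding V_def vector_2_eq_axis_sum by (intro continuous_intros)
      then show ?thesis
        using continuous_attains_inf[OF K_compact False] V_pos by blast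
    qed (auto intro: exI[of _ 1])
    then obtain v where v: "v > 0" "\<And>p. p \<in> K n \<Longrightarrow> v \<le> V p" by blast
    show ?thesis
    proof (rule lipschitz_field_zeros_null[where d = 2 and k = 3
            and C = "1 / sqrt v ^ 3" and b = "(2 * real 7 + 1)\<^sup>2"])
      show "X p \<in> borel_measurable M" for p
        unfolding X_def circle_image_def by measurable
      show "\<exists>L. L-lipschitz_on (K n) (\<lambda>p. X p \<omega>)" if "\<omega> \<in> space M" for \<omega>
      proof -
        have "k_times_continuously_differentiable 1 (\<lambda>u. \<xi> u \<omega>)"
          using assms(5)[OF that] unfolding infinitely_differentiable_def by blast
        from C1_circle_lipschitz[OF this, of 0 "2*pi"]
        obtain L where "L-lipschitz_on {0..2*pi} (\<lambda>t. circle_image \<xi> t \<omega>)"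
          by (auto simp: circle_image_def)
        from difference_lipschitz[OF this]
        have "(2 * L)-lipschitz_on (K n) (\<lambda>p. X p \<omega>)"
          unfolding X_def by (rule lipschitz_on_subset) (use \<delta>[of n] in \<open>auto simp: K_def\<close>)
        then show ?thesis by blast
      qed
      show "\<exists>F\<subseteq>K n. finite F \<and> real (card F) \<le> (2 * real 7 + 1)\<^sup>2 * real N ^ 2 \<and>
          (\<forall>p\<in>K n. \<exists>q\<in>F. dist p q \<le> 1 / real N)" if "N > 0" for N
      proof (rule plane_set_grid_cover[OF _ that])
        \<comment> \<open>Any natural number above \<open>2*pi\<close> would serve as the side of the square.\<close>
        have "2 * pi \<le> real 7" using pi_less_4 pi_approx by simp
        then show "K n \<subseteq> {0..real 7} \<times> {0..real 7}" using K_sub[of n] by force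
      qed
      show "measure M {\<omega> \<in> space M. norm (X p \<omega>) \<le> \<epsilon>} \<le> 1 / sqrt v ^ 3 * \<epsilon> ^ 3"
        if p: "p \<in> K n" and "\<epsilon> \<ge> 0" for p \<epsilon>
      proof -
        let ?u = "?c (fst p)" and ?w = "?c (snd p)"
        let ?D = "\<lambda>\<omega>. \<xi> ?u \<omega> $ 1 - \<xi> ?w \<omega> $ 1"
        have "V p > 0" using V_pos p .
        have ne: "?u \<noteq> ?w" using \<open>V p > 0\<close> by (auto simp: V_def)
        \<comment> \<open>The first coordinate of the increment as a linear functional of two values of the field.\<close>
        have "centered_gaussian M (\<lambda>\<omega>. \<Sum>x\<in>{?u, ?w}. (if x = ?u then axis 1 1 else - axis 1 1) \<bullet> \<xi> x \<omega>)"
          by (rule combination_gaussian) simp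
        then have gauss: "centered_gaussian M ?D"
          using ne by (simp add: inner_axis')
        have mom: "(\<integral>\<omega>. (?D \<omega>)\<^sup>2 \<partial>M) = V p"
          unfolding V_def
          by (rule increment_second_moment) (auto simp: assms(4))
        have "measure M {\<omega> \<in> space M. norm (X p \<omega>) \<le> \<epsilon>} \<le>
            measure M {\<omega> \<in> space M. \<bar>?D \<omega>\<bar> \<le> \<epsilon>} ^ CARD(3)"
          unfolding X_def circle_image_def
          by (rule iid_coordinates_increment_small_ball[OF assms(1,3)])
        also have "\<dots> \<le> (\<epsilon> / sqrt (V p)) ^ CARD(3)"
          using centered_gaussian_small_ball[OF assms(1) gauss mom \<open>V p > 0\<close> \<open>\<epsilon> \<ge> 0\<close>]
          by (intro power_mono) auto
        also have "\<dots> \<le> (\<epsilon> / sqrt v) ^ CARD(3)"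
          using v p \<open>\<epsilon> \<ge> 0\<close> \<open>V p > 0\<close> by (intro power_mono divide_left_mono) auto
        finally show ?thesis by (simp add: power_divide)
      qed
    qed (use assms(1) K_compact in auto)
  qed
  have "{\<omega> \<in> space M. \<exists>t\<in>{0..<2*pi}. \<exists>s\<in>{0..<2*pi}. t \<noteq> s \<and>
            circle_image \<xi> t \<omega> = circle_image \<xi> s \<omega>} = (\<Union>n. {\<omega> \<in> space M. \<exists>p\<in>K n. X p \<omega> = 0})"
    (is "?A = ?B")
  proof
    show "?B \<subseteq> ?A"
    proof safe
      fix \<omega> n t s assume p: "(t, s) \<in> K n" and z: "X (t, s) \<omega> = 0"
      then have "t \<in> {0..<2*pi}" "s \<in> {0..<2*pi}" "t \<noteq> s"
        using K_sub[of n] K_neq[OF p] p by auto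
      with z show "\<exists>t\<in>{0..<2*pi}. \<exists>s\<in>{0..<2*pi}. t \<noteq> s \<and> circle_image \<xi> t \<omega> = circle_image \<xi> s \<omega>"
        unfolding X_def by force
    qed
    show "?A \<subseteq> ?B"
    proof safe
      fix \<omega> t s assume "\<omega> \<in> space M" and ts: "t \<in> {0..<2*pi}" "s \<in> {0..<2*pi}" "t \<noteq> s"
        and eq: "circle_image \<xi> t \<omega> = circle_image \<xi> s \<omega>"
      have "min \<bar>t - s\<bar> (min (2*pi - t) (2*pi - s)) > 0" using ts by auto
      then obtain n where "\<delta> n < min \<bar>t - s\<bar> (min (2*pi - t) (2*pi - s))"
        unfolding \<delta>_def by (rule nat_approx_posE)
      then have "(t, s) \<in> K n" using ts by (auto simp: K_def)
      then show "\<omega> \<in> ?B" using eq \<open>\<omega> \<in> space M\<close> by (force simp: X_def)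
    qed
  qed
  moreover have "(\<Union>n. {\<omega> \<in> space M. \<exists>p\<in>K n. X p \<omega> = 0}) \<in> null_sets M"
    using null by (rule null_sets_UN)
  ultimately show ?thesis
    by (simp add: null_sets_def measure_def)
qed

end
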